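(* Let $\mathcal{H}_1,\mathcal{H}_2$ be real Hilbert spaces and let $C\subset\mathcal{H}_1$, $Q\subset\mathcal{H}_2$ be nonempty closed convex subsets. Let $S:C\to C$ and $T:Q\to Q$ be nonexpansive mappings, let $g:Q\times Q\to\mathbb{R}$ satisfy Assumptions A, and let $f:C\times C\to\mathbb{R}$ satisfy Assumptions B (with Lipschitz-type constants $c_1,c_2>0$). Let $A:\mathcal{H}_1\to\mathcal{H}_2$ be a bounded linear operator with adjoint $A^*$. Take $x^1\in C$; $\{\lambda_k\}\subset[a,b]$ for some $a,b\in\left(0,\min\left\{\frac{1}{2c_1},\frac{1}{2c_2}\right\}\right)$; $0<\alpha<1$; $0<\mu<\frac{1}{\|A\|^2}$; $\{\alpha_k\}\subset(0,+\infty)$ with $\liminf_{k\to+\infty}\alpha_k>0$; and consider the sequences $\{x^k\},\{y^k\},\{z^k\},\{t^k\},\{u^k\}$ defined for $k\ge 1$ by $$\begin{cases} y^k=\arg\min\left\{\lambda_k f(x^k,y)+\frac12\|y-x^k\|^2: y\in C\right\},\\ z^k=\arg\min\left\{\lambda_k f(y^k,y)+\frac12\|y-x^k\|^2: y\in C\right\},\\ t^k=(1-\alpha)z^k+\alpha S z^k,\\ u^k=T_{\alpha_k}^g A t^k,\\ x^{k+1}=P_C\left(t^k+\mu A^*(Tu^k-At^k)\right).\end{cases}$$ If $\Omega=\{x^*\in \mathrm{Sol}(C,f)\cap \mathrm{Fix}(S): Ax^*\in \mathrm{Sol}(Q,g)\cap \mathrm{Fix}(T)\}\neq\emptyset$,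 then the sequences $\{x^k\}$ and $\{z^k\}$ converge weakly to an element $p\in\Omega$ and $\{u^k\}$ converges weakly to $Ap\in \mathrm{Sol}(Q,g)\cap \mathrm{Fix}(T)$.
   Context: A mapping $S:C\to C$ is nonexpansive if $\|Sx-Sy\|\le\|x-y\|$ for all $x,y\in C$. $\mathrm{Fix}(S)=\{x\in C: Sx=x\}$ and $\mathrm{Fix}(T)=\{u\in Q: Tu=u\}$. $\mathrm{Sol}(C,f)=\{\bar x\in C: f(\bar x,y)\ge 0\ \forall y\in C\}$ and $\mathrm{Sol}(Q,g)=\{\bar u\in Q: g(\bar u,v)\ge 0\ \forall v\in Q\}$. $P_C$ is the metric projection onto $C$: $P_C(x)\in C$ and $\|x-P_C(x)\|\le\|x-y\|$ for all $y\in C$. Assumptions A on $g:Q\times Q\to\mathbb{R}$: (A1) $g(u,u)=0$ for all $u\in Q$; (A2) $g$ is monotone on $Q$: $g(u,v)+g(v,u)\le 0$ for all $u,v\in Q$; (A3) for each $u,v,w\in Q$, $\limsup_{\lambda\downarrow 0} g(\lambda w+(1-\lambda)u,v)\le g(u,v)$; (A4) $g(u,\cdot)$ is convex and lower semicontinuous on $Q$ for each $u\in Q$. Assumptions B on $f:C\times C\to\mathbb{R}$: (B1) $f(x,x)=0$ for all $x\in C$; (B2) $f$ is pseudomonotone on $C$: $f(x,y)\ge 0$ implies $f(y,x)\le 0$, for all $x,y\in C$; (B3) $f$ is jointly weakly continuous on $C\times C$: if $x,y\in C$ and sequences $\{x^k\},\{y^k\}\subset C$ converge weakly to $x$ and $y$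 respectively, then $f(x^k,y^k)\to f(x,y)$; (B4) $f(x,\cdot)$ is convex and subdifferentiable on $C$ for all $x\in C$; (B5) $f$ is Lipschitz-type continuous on $C$ with constants $c_1>0$, $c_2>0$: $f(x,y)+f(y,z)\ge f(x,z)-c_1\|x-y\|^2-c_2\|y-z\|^2$ for all $x,y,z\in C$. For $\alpha>0$ and $u\in\mathcal{H}_2$, $T_\alpha^g(u)$ denotes the (unique, under Assumptions A) point $w\in Q$ such that $g(w,v)+\frac1\alpha\langle v-w,w-u\rangle\ge 0$ for all $v\in Q$. *)

theory Defs
  imports "HOL-Analysis.Analysis"
begin

definition weakly_convergent_to :: "(nat \<Rightarrow> 'a::real_normed_vector) \<Rightarrow> 'a \<Rightarrow> bool" where
  "weakly_convergent_to X p \<longleftrightarrow>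
     (\<forall>\<phi> :: 'a \<Rightarrow> real. bounded_linear \<phi> \<longrightarrow> (\<lambda>n. \<phi> (X n)) \<longlonglongrightarrow> \<phi> p)"

definition nonexpansive_on :: "'a::real_normed_vector set \<Rightarrow> ('a \<Rightarrow> 'a) \<Rightarrow> bool" where
  "nonexpansive_on C S \<longleftrightarrow>
     S \<in> C \<rightarrow> C \<and> (\<forall>x\<in>C. \<forall>y\<in>C. norm (S x - S y) \<le> norm (x - y))"

definition Fix :: "'a set \<Rightarrow> ('a \<Rightarrow> 'a) \<Rightarrow> 'a set" where
  "Fix C S = {x \<in> C. S x = x}"

definition Sol :: "'a set \<Rightarrow> ('a \<Rightarrow> 'a \<Rightarrow> real) \<Rightarrow> 'a set" where
  "Sol C f = {x \<in> C. \<forall>y\<in>C. f x y \<ge> 0}"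

definition lsc_on :: "'a::topological_space set \<Rightarrow> ('a \<Rightarrow> real) \<Rightarrow> bool" where
  "lsc_on C h \<longleftrightarrow> (\<forall>x\<in>C. ereal (h x) \<le> Liminf (at x within C) (\<lambda>y. ereal (h y)))"

text \<open>Functions are only meaningful on \<open>C\<close>, so subgradient inequalities are tested on \<open>C\<close>.\<close>

definition subdifferential_on :: "'a::real_inner set \<Rightarrow> ('a \<Rightarrow> real) \<Rightarrow> 'a \<Rightarrow> 'a set" where
  "subdifferential_on C h y = {w. \<forall>z\<in>C. h z - h y \<ge> w \<bullet> (z - y)}"

definition subdifferentiable_on :: "'a::real_inner set \<Rightarrow> ('a \<Rightarrow> real) \<Rightarrow> bool" where
  "subdifferentiable_on C h \<longleftrightarrow> (\<forall>y\<in>C. subdifferential_on C h y \<noteq> {})"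

definition assumptions_A :: "'a::real_inner set \<Rightarrow> ('a \<Rightarrow> 'a \<Rightarrow> real) \<Rightarrow> bool" where
  "assumptions_A Q g \<longleftrightarrow>
     (\<forall>u\<in>Q. g u u = 0) \<and>
     (\<forall>u\<in>Q. \<forall>v\<in>Q. g u v + g v u \<le> 0) \<and>
     (\<forall>u\<in>Q. \<forall>v\<in>Q. \<forall>w\<in>Q.
        Limsup (at_right 0) (\<lambda>l. ereal (g (l *\<^sub>R w + (1 - l) *\<^sub>R u) v)) \<le> ereal (g u v)) \<and>
     (\<forall>u\<in>Q. convex_on Q (g u) \<and> lsc_on Q (g u))"

definition jointly_weakly_continuous_on ::
    "'a::real_normed_vector set \<Rightarrow> ('a \<Rightarrow> 'a \<Rightarrow> real) \<Rightarrow> bool" where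
  "jointly_weakly_continuous_on C f \<longleftrightarrow>
     (\<forall>x\<in>C. \<forall>y\<in>C. \<forall>X Y.
        (\<forall>k. X k \<in> C) \<longrightarrow> (\<forall>k. Y k \<in> C) \<longrightarrow>
        weakly_convergent_to X x \<longrightarrow> weakly_convergent_to Y y \<longrightarrow>
        (\<lambda>k. f (X k) (Y k)) \<longlonglongrightarrow> f x y)"

definition lipschitz_type_on ::
    "'a::real_normed_vector set \<Rightarrow> real \<Rightarrow> real \<Rightarrow> ('a \<Rightarrow> 'a \<Rightarrow> real) \<Rightarrow> bool" where
  "lipschitz_type_on C c1 c2 f \<longleftrightarrow>
     (\<forall>x\<in>C. \<forall>y\<in>C. \<forall>z\<in>C.
        f x y + f y z \<ge> f x z - c1 * (norm (x - y))\<^sup>2 - c2 * (norm (y - z))\<^sup>2)"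

definition assumptions_B ::
    "'a::real_inner set \<Rightarrow> real \<Rightarrow> real \<Rightarrow> ('a \<Rightarrow> 'a \<Rightarrow> real) \<Rightarrow> bool" where
  "assumptions_B C c1 c2 f \<longleftrightarrow>
     (\<forall>x\<in>C. f x x = 0) \<and>
     (\<forall>x\<in>C. \<forall>y\<in>C. f x y \<ge> 0 \<longrightarrow> f y x \<le> 0) \<and>
     jointly_weakly_continuous_on C f \<and>
     (\<forall>x\<in>C. convex_on C (f x) \<and> subdifferentiable_on C (f x)) \<and>
     c1 > 0 \<and> c2 > 0 \<and> lipschitz_type_on C c1 c2 f"

text \<open>
  The next two definitions are the graphs of the metric projection \<open>p = P\<^sub>C(x)\<close> and of the
  resolvent \<open>w = T\<^sub>r\<^sup>g(u)\<close>. In a Hilbert space, with \<open>C\<close> and \<open>Q\<close> nonempty, closed and convex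
  (and \<open>g\<close> satisfying \<open>assumptions_A\<close>, \<open>r > 0\<close>), both relations are total and single-valued.
\<close>

definition is_metric_projection :: "'a::real_normed_vector set \<Rightarrow> 'a \<Rightarrow> 'a \<Rightarrow> bool" where
  "is_metric_projection C x p \<longleftrightarrow> p \<in> C \<and> (\<forall>y\<in>C. norm (x - p) \<le> norm (x - y))"

definition is_resolvent ::
    "'a::real_inner set \<Rightarrow> ('a \<Rightarrow> 'a \<Rightarrow> real) \<Rightarrow> real \<Rightarrow> 'a \<Rightarrow> 'a \<Rightarrow> bool" where
  "is_resolvent Q g r u w \<longleftrightarrow>
     w \<in> Q \<and> (\<forall>v\<in>Q. g w v + (1 / r) * ((v - w) \<bullet> (w - u)) \<ge> 0)"

end

theory Submission
  imports Defs "HOL-Complex_Analysis.Great_Picard"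
begin

text \<open>
  Fix a solution \<open>w \<in> \<Omega>\<close>. The theorem holds because each stage of one iteration moves the
  current point no further from \<open>w\<close> (or, on the \<open>Q\<close> side, from \<open>A w\<close>), and what it gains is a
  multiple of a squared residual:

  \<^item> the two proximal steps gain the squares of \<open>x - y\<close> and \<open>y - z\<close>
    (\<open>extragradient_step\<close>); the gain is uniform because the step sizes are at most \<open>b\<close>, and
    \<open>b < 1 / (2 * c1)\<close> and \<open>b < 1 / (2 * c2)\<close>;
  \<^item> averaging with \<open>S\<close> gains the square of \<open>z - S z\<close> (\<open>averaged_step\<close>);
  \<^item> the resolvent, followed by \<open>T\<close> and pulled back through the adjoint of \<open>A\<close>, gains the squares
    of \<open>T u - A t\<close> and \<open>u - A t\<close> (\<open>resolvent_step\<close>, \<open>split_correction_step\<close>), which is where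
    \<open>\<mu>\<close> times the squared operator norm has to be below 1.

  Adding up, the distance of the iterates to every point of \<open>\<Omega>\<close> is nonincreasing, hence convergent,
  and the gains tend to zero, so all these residuals do. In particular \<open>x\<close>, \<open>y\<close>, \<open>z\<close>, \<open>t\<close> have the
  same weak cluster points, and \<open>u\<close> shares those of \<open>A x\<close>.

  A weak cluster point \<open>p\<close> of \<open>x\<close> lies in \<open>\<Omega>\<close>: vanishing residuals put \<open>p\<close> and \<open>A p\<close> into the
  fixed point sets by demiclosedness (\<open>demiclosedness\<close>), the optimality condition of \<open>y\<close> passes to
  the limit by the weak continuity of \<open>f\<close> (\<open>weak_limit_of_prox_steps_in_Sol\<close>), and the resolvent
  inequality passes to the limit in its monotone dual form, from which Minty's trick recovers the
  equilibrium problem for \<open>g\<close> (\<open>weak_limit_of_resolvents_in_Sol\<close>). Finally a bounded sequence whose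
  distance to every point of a set converges, and whose weak cluster points all lie in that set,
  converges weakly (\<open>fejer_weak_convergence\<close>).

  The Hilbert space theory behind this (projections, the Riesz representation, adjoints, weak
  sequential compactness) is derived from the minimisation of a single quadratic functional on a
  closed convex set (\<open>lions_stampacchia\<close>).
\<close>

section \<open>Convex minimisation and duality in Hilbert spaces\<close>

text \<open>
  The first-order optimality condition for \<open>h\<close> plus half the squared distance to \<open>x\<close>: compare the minimiser with a point at parameter \<open>s\<close> on the segment towards
  \<open>v\<close>, divide by \<open>s\<close> and let \<open>s\<close> tend to 0.
\<close>

lemma prox_inequality:
  fixes C :: "'a::real_inner set"
  assumes h: "convex_on C h" and z: "z \<in> C" and v: "v \<in> C"
    and min: "\<And>w. w \<in> C \<Longrightarrow> h z + 1/2 * (norm (z - x))\<^sup>2 \<le> h w + 1/2 * (norm (w - x))\<^sup>2"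
  shows "(x - z) \<bullet> (v - z) \<le> h v - h z"
proof -
  let ?D = "h v - h z + (z - x) \<bullet> (v - z)" and ?N = "(norm (v - z))\<^sup>2"
  have pos: "0 \<le> ?D + s / 2 * ?N" if s: "0 < s" "s \<le> 1" for s :: real
  proof -
    let ?w = "(1 - s) *\<^sub>R z + s *\<^sub>R v"
    have "convex C" using h by (rule convex_on_imp_convex)
    then have w: "?w \<in> C" using s z v by (simp add: convexD)
    have hw: "h ?w \<le> (1 - s) * h z + s * h v"
      using convex_onD[OF h, of s z v] s z v by simp
    have "?w - x = (z - x) + s *\<^sub>R (v - z)" by (simp add: algebra_simps)
    then have nw: "(norm (?w - x))\<^sup>2 = (norm (z - x))\<^sup>2 + 2 * (s * ((z - x) \<bullet> (v - z))) + s\<^sup>2 * ?N"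
      unfolding power2_norm_eq_inner by (simp add: inner_commute algebra_simps power2_eq_square)
    have "0 \<le> s * ?D + s\<^sup>2 / 2 * ?N"
      using min[OF w] hw nw by (simp add: algebra_simps)
    then have "0 \<le> s * (?D + s / 2 * ?N)" by (simp add: algebra_simps power2_eq_square)
    then show ?thesis using s by (simp add: zero_le_mult_iff)
  qed
  have "((\<lambda>s. ?D + s / 2 * ?N) \<longlongrightarrow> ?D + 0 / 2 * ?N) (at_right 0)"
    by (intro tendsto_intros) auto
  moreover have "\<forall>\<^sub>F s in at_right 0. 0 \<le> ?D + s / 2 * ?N"
    unfolding eventually_at_right_field using pos by (intro exI[of _ 1]) fastforce
  ultimately have "0 \<le> ?D + 0 / 2 * ?N"
    by (intro tendsto_lowerbound[where F="at_right (0::real)"]) auto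
  then show ?thesis by (simp add: algebra_simps)
qed

text \<open>
  Existence for the variational inequality of a linear functional. The functional
  \<open>1/2 * (norm v)\<^sup>2 - \<phi> v\<close> is bounded below and, by the parallelogram law, its minimising sequences are
  Cauchy. Taking \<open>\<phi> = (\<lambda>v. x \<bullet> v)\<close> gives the metric projection of \<open>x\<close>; taking \<open>C\<close> to be a subspace
  gives the Riesz representation.
\<close>

lemma lions_stampacchia:
  fixes C :: "'a::{real_inner, complete_space} set"
  assumes C: "C \<noteq> {}" "closed C" "convex C" and \<phi>: "bounded_linear \<phi>"
  shows "\<exists>p\<in>C. \<forall>v\<in>C. \<phi> (v - p) \<le> p \<bullet> (v - p)"
proof -
  interpret \<phi>: bounded_linear \<phi> by fact
  define F where "F v = 1/2 * (norm v)\<^sup>2 - \<phi> v" for v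
  obtain K where K: "\<And>v. norm (\<phi> v) \<le> norm v * K" using \<phi>.bounded by blast
  have low: "- (K\<^sup>2 / 2) \<le> F v" for v
  proof -
    have "0 \<le> (norm v - K)\<^sup>2" by simp
    then show ?thesis using K[of v] by (simp add: F_def power2_eq_square algebra_simps abs_le_iff)
  qed
  define m where "m = Inf (F ` C)"
  have bdd: "bdd_below (F ` C)" using low by (auto intro!: bdd_belowI)
  have m_le: "m \<le> F v" if "v \<in> C" for v
    unfolding m_def using bdd that by (auto intro: cInf_lower)
  have "\<exists>v\<in>C. F v < m + inverse (real (Suc n))" for n
  proof -
    have "Inf (F ` C) < m + inverse (real (Suc n))" by (simp add: m_def)
    then show ?thesis using cInf_lessD[of "F ` C"] C(1) by force
  qed
  then obtain V where V: "\<And>n. V n \<in> C" "\<And>n. F (V n) < m + inverse (real (Suc n))" by metis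
  have par: "1/4 * (norm (v - w))\<^sup>2 \<le> (F v - m) + (F w - m)" if "v \<in> C" "w \<in> C" for v w
  proof -
    let ?c = "(1/2) *\<^sub>R v + (1/2) *\<^sub>R w"
    have "?c \<in> C" using C(3) that by (intro convexD) auto
    moreover have "1/4 * (norm (v - w))\<^sup>2 = F v + F w - 2 * F ?c"
      unfolding F_def power2_norm_eq_inner
      by (simp add: \<phi>.add \<phi>.scaleR inner_commute algebra_simps)
    ultimately show ?thesis using m_le[of ?c] by simp
  qed
  have "Cauchy V"
  proof (rule metric_CauchyI)
    fix e :: real assume e: "0 < e"
    then obtain N where N: "inverse (real (Suc N)) < e\<^sup>2 / 8"
      using reals_Archimedean[of "e\<^sup>2/8"] by auto
    have Fn: "F (V n) - m < e\<^sup>2 / 8" if "N \<le> n" for n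
    proof -
      have "inverse (real (Suc n)) \<le> inverse (real (Suc N))" using that by (intro le_imp_inverse_le) auto
      then show ?thesis using V(2)[of n] N by linarith
    qed
    have "dist (V k) (V n) < e" if "N \<le> k" "N \<le> n" for k n
    proof -
      have "(norm (V k - V n))\<^sup>2 < e\<^sup>2"
        using par[OF V(1) V(1), of k n] Fn[OF that(1)] Fn[OF that(2)] by linarith
      then show ?thesis using e by (simp add: dist_norm power_less_imp_less_base)
    qed
    then show "\<exists>N. \<forall>k\<ge>N. \<forall>n\<ge>N. dist (V k) (V n) < e" by blast
  qed
  then obtain p where p: "V \<longlonglongrightarrow> p" using Cauchy_convergent convergent_def by blast
  have pC: "p \<in> C" using closed_sequentially[OF C(2) V(1) p] .
  have "(\<lambda>n. F (V n)) \<longlonglongrightarrow> F p"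
    unfolding F_def by (intro tendsto_intros p \<phi>.tendsto)
  moreover have "(\<lambda>n. m + inverse (real (Suc n))) \<longlonglongrightarrow> m + 0"
    by (intro tendsto_intros LIMSEQ_inverse_real_of_nat)
  ultimately have "F p \<le> m + 0"
    by (rule LIMSEQ_le) (use V(2) in \<open>auto intro!: exI[of _ 0] less_imp_le\<close>)
  then have min: "F p \<le> F v" if "v \<in> C" for v using m_le[OF that] by simp
  have conv: "convex_on C (\<lambda>v. - \<phi> v)"
    using C(3) by (auto intro!: convex_onI simp: \<phi>.add \<phi>.scaleR)
  have "\<phi> (v - p) \<le> p \<bullet> (v - p)" if v: "v \<in> C" for v
    using prox_inequality[OF conv pC v, of 0] min
    by (simp add: F_def \<phi>.diff algebra_simps)
  with pC show ?thesis by blast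
qed

text \<open>
  On a subspace the test vectors \<open>p + h\<close> and \<open>p - h\<close> are both admissible, so the variational
  inequality becomes an equation.
\<close>

lemma riesz_on_subspace:
  fixes M :: "'a::{real_inner, complete_space} set"
  assumes M: "subspace M" "closed M" and \<phi>: "bounded_linear \<phi>"
  shows "\<exists>p\<in>M. \<forall>h\<in>M. \<phi> h = p \<bullet> h"
proof -
  interpret \<phi>: bounded_linear \<phi> by fact
  have ne: "M \<noteq> {}" using subspace_0[OF M(1)] by auto
  obtain p where p: "p \<in> M" "\<And>v. v \<in> M \<Longrightarrow> \<phi> (v - p) \<le> p \<bullet> (v - p)"
    using lions_stampacchia[OF ne M(2) subspace_imp_convex[OF M(1)] \<phi>] by auto
  have "\<phi> h = p \<bullet> h" if h: "h \<in> M" for h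
  proof -
    have "\<phi> (p + h - p) \<le> p \<bullet> (p + h - p)" "\<phi> (p - h - p) \<le> p \<bullet> (p - h - p)"
      by (intro p(2) subspace_add subspace_diff M(1) p(1) h)+
    then show ?thesis by (simp add: \<phi>.neg)
  qed
  with p(1) show ?thesis by blast
qed

lemma riesz_representation:
  fixes \<phi> :: "'a::{real_inner, complete_space} \<Rightarrow> real"
  assumes "bounded_linear \<phi>"
  shows "\<exists>p. \<forall>h. \<phi> h = h \<bullet> p"
  using riesz_on_subspace[OF subspace_UNIV closed_UNIV assms] by (auto simp: inner_commute)

text \<open>
  The constant \<open>adjoint\<close> is defined by choice, so its characteristic equation needs an existence
  proof; on a complete space the Riesz representation of \<open>\<lambda>x. A x \<bullet> y\<close> provides one.
\<close>

lemma inner_adjoint: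
  fixes A :: "'a::{real_inner, complete_space} \<Rightarrow> 'b::real_inner"
  assumes A: "bounded_linear A"
  shows "A x \<bullet> y = x \<bullet> adjoint A y"
proof -
  have "\<exists>w. \<forall>x. A x \<bullet> y = x \<bullet> w" for y
  proof -
    have "bounded_linear (\<lambda>x. A x \<bullet> y)" using A by (rule bounded_linear_inner_left_comp)
    then show ?thesis by (rule riesz_representation)
  qed
  then have "\<exists>A'. \<forall>x y. A x \<bullet> y = x \<bullet> A' y" by metis
  then show ?thesis unfolding adjoint_def by (rule someI2_ex) blast
qed

lemma norm_adjoint_le:
  fixes A :: "'a::{real_inner, complete_space} \<Rightarrow> 'b::real_inner"
  assumes A: "bounded_linear A"
  shows "norm (adjoint A y) \<le> onorm A * norm y"
proof (cases "adjoint A y = 0")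
  case True
  then show ?thesis using onorm_pos_le[OF A] by simp
next
  case False
  let ?w = "adjoint A y"
  have "norm ?w * norm ?w = A ?w \<bullet> y"
    using inner_adjoint[OF A, of ?w y] by (simp add: power2_norm_eq_inner flip: power2_eq_square)
  also have "\<dots> \<le> norm (A ?w) * norm y" by (rule norm_cauchy_schwarz)
  also have "\<dots> \<le> onorm A * norm ?w * norm y" by (intro mult_right_mono onorm[OF A]) auto
  finally have "norm ?w * norm ?w \<le> norm ?w * (onorm A * norm y)" by (simp add: algebra_simps)
  then show ?thesis using False by simp
qed

section \<open>Weak convergence\<close>

lemma weakly_convergent_to_iff_inner:
  fixes X :: "nat \<Rightarrow> 'a::{real_inner, complete_space}"
  shows "weakly_convergent_to X p \<longleftrightarrow> (\<forall>v. (\<lambda>n. X n \<bullet> v) \<longlonglongrightarrow> p \<bullet> v)"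
proof
  assume "weakly_convergent_to X p"
  then show "\<forall>v. (\<lambda>n. X n \<bullet> v) \<longlonglongrightarrow> p \<bullet> v"
    unfolding weakly_convergent_to_def using bounded_linear_inner_left by blast
next
  assume R: "\<forall>v. (\<lambda>n. X n \<bullet> v) \<longlonglongrightarrow> p \<bullet> v"
  show "weakly_convergent_to X p"
    unfolding weakly_convergent_to_def
  proof (intro allI impI)
    fix \<phi> :: "'a \<Rightarrow> real" assume "bounded_linear \<phi>"
    then obtain q where "\<And>h. \<phi> h = h \<bullet> q" using riesz_representation by blast
    then show "(\<lambda>n. \<phi> (X n)) \<longlonglongrightarrow> \<phi> p" using R by simp
  qed
qed

lemma weakly_convergent_to_subseq:
  assumes X: "weakly_convergent_to X p" and r: "strict_mono r"
  shows "weakly_convergent_to (X \<circ> r) p"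
  unfolding weakly_convergent_to_def
proof (intro allI impI)
  fix \<phi> :: "'a \<Rightarrow> real" assume \<phi>: "bounded_linear \<phi>"
  then have "(\<lambda>n. \<phi> (X n)) \<longlonglongrightarrow> \<phi> p" using X by (simp add: weakly_convergent_to_def)
  from LIMSEQ_subseq_LIMSEQ[OF this r] show "(\<lambda>n. \<phi> ((X \<circ> r) n)) \<longlonglongrightarrow> \<phi> p"
    by (simp add: o_def)
qed

lemma weakly_convergent_to_Suc:
  "weakly_convergent_to (\<lambda>n. X (Suc n)) p \<longleftrightarrow> weakly_convergent_to X p"
  unfolding weakly_convergent_to_def by (simp add: filterlim_sequentially_Suc[where f="\<lambda>n. _ (X n)"])

lemma weakly_convergent_to_perturb:
  assumes X: "weakly_convergent_to X p" and d: "(\<lambda>n. Y n - X n) \<longlonglongrightarrow> 0"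
  shows "weakly_convergent_to Y p"
  unfolding weakly_convergent_to_def
proof (intro allI impI)
  fix \<phi> :: "'a \<Rightarrow> real" assume \<phi>: "bounded_linear \<phi>"
  have "(\<lambda>n. \<phi> (X n)) \<longlonglongrightarrow> \<phi> p" using X \<phi> by (simp add: weakly_convergent_to_def)
  from tendsto_add[OF this bounded_linear.tendsto[OF \<phi> d]]
  show "(\<lambda>n. \<phi> (Y n)) \<longlonglongrightarrow> \<phi> p"
    using \<phi> by (simp add: bounded_linear.linear linear_diff linear_0)
qed

lemma weakly_convergent_to_image:
  assumes X: "weakly_convergent_to X p" and A: "bounded_linear A"
  shows "weakly_convergent_to (\<lambda>n. A (X n)) (A p)"
  unfolding weakly_convergent_to_def
proof (intro allI impI)
  fix \<phi> :: "'b \<Rightarrow> real" assume "bounded_linear \<phi>"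
  from X[unfolded weakly_convergent_to_def, rule_format, OF bounded_linear_compose[OF this A]]
  show "(\<lambda>n. \<phi> (A (X n))) \<longlonglongrightarrow> \<phi> (A p)" .
qed

text \<open>
  Project the weak limit \<open>p\<close> to \<open>q\<close>: the variational inequality separates the set from \<open>p\<close> by
  a hyperplane, and this half-space inequality survives the weak limit, forcing \<open>p = q\<close>.
\<close>

lemma weak_limit_in_closed_convex:
  fixes C :: "'a::{real_inner, complete_space} set"
  assumes C: "closed C" "convex C" and X: "weakly_convergent_to X p"
    and ev: "\<forall>\<^sub>F n in sequentially. X n \<in> C"
  shows "p \<in> C"
proof -
  have ne: "C \<noteq> {}" using ev by (auto dest: eventually_happens)
  obtain q where q: "q \<in> C" "\<And>v. v \<in> C \<Longrightarrow> p \<bullet> (v - q) \<le> q \<bullet> (v - q)"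
    using lions_stampacchia[OF ne C bounded_linear_inner_right[of p]] by auto
  have "(\<lambda>n. X n \<bullet> (p - q)) \<longlonglongrightarrow> p \<bullet> (p - q)"
    using X by (simp add: weakly_convergent_to_iff_inner)
  moreover have "\<forall>\<^sub>F n in sequentially. X n \<bullet> (p - q) \<le> q \<bullet> (p - q)"
    using ev by eventually_elim (use q(2) in \<open>fastforce simp: inner_diff inner_commute\<close>)
  ultimately have "p \<bullet> (p - q) \<le> q \<bullet> (p - q)" by (intro tendsto_upperbound) auto
  then have "(p - q) \<bullet> (p - q) \<le> 0" by (simp add: inner_diff_left)
  then have "p = q" by (metis eq_iff_diff_eq_0 inner_gt_zero_iff not_le)
  with q(1) show ?thesis by simp
qed

text \<open>
  Weak sequential compactness of balls, also in non-separable spaces. A diagonal argument makes the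
  inner products with the countably many \<open>X m\<close> converge. The vectors \<open>w\<close> for which \<open>X (r n) \<bullet> w\<close>
  converges then form a closed subspace containing all \<open>X m\<close>, and replacing an arbitrary \<open>w\<close> by its
  orthogonal projection onto that subspace does not change the inner products. Riesz represents
  the resulting limit functional.
\<close>

lemma bounded_imp_weakly_convergent_subseq:
  fixes X :: "nat \<Rightarrow> 'a::{real_inner, complete_space}"
  assumes "bounded (range X)"
  obtains r p where "strict_mono r" "weakly_convergent_to (X \<circ> r) p"
proof -
  obtain K where K: "0 < K" "\<And>n. norm (X n) \<le> K"
    using assms by (auto simp: bounded_pos)
  have XK: "\<bar>X n \<bullet> w\<bar> \<le> K * norm w" for n w
    using Cauchy_Schwarz_ineq2[of "X n" w] mult_right_mono[OF K(2)[of n], of "norm w"] by simp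
  define f where "f n m = X n \<bullet> X m" for n m
  have f_le: "norm (f n m) \<le> K * K" for n m
    using XK[of n "X m"] mult_left_mono[OF K(2)[of m], of K] K(1) unfolding f_def real_norm_def by linarith
  have "\<exists>r. strict_mono r \<and> (\<forall>m. \<exists>l. (\<lambda>n. f (r n) m) \<longlonglongrightarrow> l)"
    by (rule function_convergent_subsequence[of UNIV f "K * K"]) (use f_le in auto)
  then obtain r where r: "strict_mono r" "\<And>m. \<exists>l. (\<lambda>n. f (r n) m) \<longlonglongrightarrow> l"
    by blast
  define M where "M = {w. convergent (\<lambda>n. X (r n) \<bullet> w)}"
  have XM: "X m \<in> M" for m using r(2)[of m] by (simp add: M_def f_def convergent_def)
  have sub: "subspace M"
    unfolding subspace_def M_def
    by (auto simp: inner_add_right convergent_const intro: convergent_add convergent_mult)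
  have "w \<in> M" if w: "w \<in> closure M" for w
  proof -
    have "Cauchy (\<lambda>n. X (r n) \<bullet> w)"
    proof (rule metric_CauchyI)
      fix e :: real assume e: "0 < e"
      then have "0 < e / (3 * K)" using K(1) by simp
      then obtain w' where w': "w' \<in> M" "dist w' w < e / (3 * K)"
        using w unfolding closure_approachable by blast
      then have Kw: "K * norm (w - w') < e / 3"
        using K(1) by (simp add: dist_norm norm_minus_commute field_simps)
      have near: "\<bar>X n \<bullet> w - X n \<bullet> w'\<bar> < e / 3" for n
        using XK[of n "w - w'"] Kw by (simp add: inner_diff_right)
      have "Cauchy (\<lambda>n. X (r n) \<bullet> w')" using w'(1) by (simp add: M_def convergent_Cauchy)
      then obtain N where N: "\<And>m n. m \<ge> N \<Longrightarrow> n \<ge> N \<Longrightarrow> dist (X (r m) \<bullet> w') (X (r n) \<bullet> w') < e / 3"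
        using metric_CauchyD[of _ "e/3"] e by force
      have "dist (X (r m) \<bullet> w) (X (r n) \<bullet> w) < e" if "m \<ge> N" "n \<ge> N" for m n
        using N[OF that] near[of "r m"] near[of "r n"] unfolding dist_real_def by linarith
      then show "\<exists>N. \<forall>m\<ge>N. \<forall>n\<ge>N. dist (X (r m) \<bullet> w) (X (r n) \<bullet> w) < e" by blast
    qed
    then show ?thesis by (simp add: M_def Cauchy_convergent)
  qed
  then have cl: "closed M" by (metis closure_subset_eq subsetI)
  have conv: "convergent (\<lambda>n. X (r n) \<bullet> w)" for w
  proof -
    obtain q where q: "q \<in> M" "\<And>h. h \<in> M \<Longrightarrow> w \<bullet> h = q \<bullet> h"
      using riesz_on_subspace[OF sub cl bounded_linear_inner_right[of w]] by auto
    then have "X (r n) \<bullet> w = X (r n) \<bullet> q" for n using XM by (metis inner_commute)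
    then show ?thesis using q(1) by (simp add: M_def)
  qed
  define \<phi> where "\<phi> w = lim (\<lambda>n. X (r n) \<bullet> w)" for w
  have lim: "(\<lambda>n. X (r n) \<bullet> w) \<longlonglongrightarrow> \<phi> w" for w
    using conv[of w] by (simp add: \<phi>_def convergent_LIMSEQ_iff)
  have "bounded_linear \<phi>"
  proof (rule bounded_linear_intro)
    show "\<phi> (v + w) = \<phi> v + \<phi> w" for v w
      using LIMSEQ_unique[OF lim[of "v + w"]] tendsto_add[OF lim[of v] lim[of w]]
      by (simp add: inner_add_right)
    show "\<phi> (c *\<^sub>R w) = c *\<^sub>R \<phi> w" for c w
      using LIMSEQ_unique[OF lim[of "c *\<^sub>R w"]] tendsto_mult[OF tendsto_const lim[of w], of c]
      by simp
    show "norm (\<phi> w) \<le> norm w * K" for w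
      by (rule tendsto_upperbound[OF tendsto_norm[OF lim[of w]]])
        (use XK in \<open>auto simp: mult.commute\<close>)
  qed
  then obtain p where "\<And>w. \<phi> w = w \<bullet> p" using riesz_representation by blast
  then have "weakly_convergent_to (X \<circ> r) p"
    using lim by (simp add: weakly_convergent_to_iff_inner inner_commute)
  with r(1) that show ?thesis by blast
qed

lemma norm_diff_sq:
  fixes x y :: "'a::real_inner"
  shows "(norm (x - y))\<^sup>2 = (norm x)\<^sup>2 - 2 * (x \<bullet> y) + (norm y)\<^sup>2"
  by (simp add: power2_norm_eq_inner inner_diff inner_commute)

text \<open>
  Expanding the square of \<open>X n - S p = (X n - p) + (p - S p)\<close>, the cross term vanishes weakly,
  while nonexpansiveness bounds the left side by the square of \<open>norm (X n - p)\<close> up to a vanishing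
  error. What remains is \<open>norm (p - S p)\<close>, so it must be zero.
\<close>

lemma demiclosedness:
  fixes C :: "'a::{real_inner, complete_space} set"
  assumes C: "closed C" "convex C" and S: "nonexpansive_on C S"
    and X: "\<And>n. X n \<in> C" "weakly_convergent_to X p" "bounded (range X)"
    and res: "(\<lambda>n. X n - S (X n)) \<longlonglongrightarrow> 0"
  shows "p \<in> Fix C S"
proof -
  have p: "p \<in> C" using weak_limit_in_closed_convex[OF C X(2)] X(1) by simp
  obtain K where K: "\<And>n. norm (X n) \<le> K" using X(3) by (auto simp: bounded_iff)
  define d where "d n = norm (X n - S (X n))" for n
  have d: "d \<longlonglongrightarrow> 0" unfolding d_def using tendsto_norm_zero[OF res] .
  have "(norm (p - S p))\<^sup>2 \<le> d n * (d n + 2 * (K + norm p)) - 2 * ((X n - p) \<bullet> (p - S p))" for n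
  proof -
    have a: "norm (X n - p) \<le> K + norm p" using K[of n] norm_triangle_ineq4[of "X n" p] by linarith
    have "norm (X n - S p) \<le> d n + norm (S (X n) - S p)"
      using norm_triangle_ineq[of "X n - S (X n)" "S (X n) - S p"] by (simp add: d_def)
    also have "norm (S (X n) - S p) \<le> norm (X n - p)"
      using S X(1) p by (auto simp: nonexpansive_on_def)
    finally have "(norm (X n - S p))\<^sup>2 \<le> (d n + norm (X n - p))\<^sup>2" by (intro power_mono) auto
    moreover have "(norm (X n - S p))\<^sup>2 = (norm (X n - p))\<^sup>2 + 2 * ((X n - p) \<bullet> (p - S p)) + (norm (p - S p))\<^sup>2"
      by (simp add: power2_norm_eq_inner inner_diff inner_commute)
    moreover have "d n * norm (X n - p) \<le> d n * (K + norm p)"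
      using a by (intro mult_left_mono) (auto simp: d_def)
    ultimately show ?thesis by (simp add: power2_eq_square algebra_simps)
  qed
  moreover have "(\<lambda>n. d n * (d n + 2 * (K + norm p)) - 2 * ((X n - p) \<bullet> (p - S p)))
      \<longlonglongrightarrow> 0 * (0 + 2 * (K + norm p)) - 2 * ((p - p) \<bullet> (p - S p))"
    unfolding inner_diff_left
    by (intro tendsto_add tendsto_diff tendsto_mult tendsto_const d)
      (use X(2) in \<open>simp add: weakly_convergent_to_iff_inner\<close>)
  ultimately have "(norm (p - S p))\<^sup>2 \<le> 0 * (0 + 2 * (K + norm p)) - 2 * ((p - p) \<bullet> (p - S p))"
    by (intro tendsto_lowerbound) auto
  then show ?thesis using p by (simp add: Fix_def)
qed

text \<open>
  Opial's argument. If \<open>p\<close> and \<open>q\<close> are weak cluster points, both in \<open>W\<close>, then the difference of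
  the squared distances to \<open>p\<close> and to \<open>q\<close> converges, and with it \<open>X n \<bullet> (q - p)\<close>; its limits along the
  two subsequences agree, which gives \<open>p = q\<close>. Weak compactness turns uniqueness of the cluster point
  into convergence.
\<close>

lemma fejer_weak_convergence:
  fixes X :: "nat \<Rightarrow> 'a::{real_inner, complete_space}"
  assumes ne: "W \<noteq> {}" and bX: "bounded (range X)"
    and conv: "\<And>w. w \<in> W \<Longrightarrow> convergent (\<lambda>n. norm (X n - w))"
    and cl: "\<And>r p. strict_mono r \<Longrightarrow> weakly_convergent_to (X \<circ> r) p \<Longrightarrow> p \<in> W"
  obtains p where "p \<in> W" "weakly_convergent_to X p"
proof -
  obtain r p where r: "strict_mono r" and p: "weakly_convergent_to (X \<circ> r) p"
    using bounded_imp_weakly_convergent_subseq[OF bX] .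
  have pW: "p \<in> W" using cl[OF r p] .
  have uniq: "q = p" if s: "strict_mono s" and q: "weakly_convergent_to (X \<circ> s) q" for s q
  proof -
    have qW: "q \<in> W" using cl[OF s q] .
    obtain lp lq where lp: "(\<lambda>n. norm (X n - p)) \<longlonglongrightarrow> lp" and lq: "(\<lambda>n. norm (X n - q)) \<longlonglongrightarrow> lq"
      using conv[OF pW] conv[OF qW] by (auto simp: convergent_def)
    have eq: "X n \<bullet> (q - p) = ((norm (X n - p))\<^sup>2 - (norm (X n - q))\<^sup>2 + (norm q)\<^sup>2 - (norm p)\<^sup>2) / 2" for n
      unfolding norm_diff_sq by (simp add: inner_diff_right)
    define L where "L = (lp\<^sup>2 - lq\<^sup>2 + (norm q)\<^sup>2 - (norm p)\<^sup>2) / 2"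
    have L: "(\<lambda>n. X n \<bullet> (q - p)) \<longlonglongrightarrow> L"
      unfolding eq L_def by (intro tendsto_intros lp lq) auto
    have "p \<bullet> (q - p) = L"
      using LIMSEQ_unique[OF _ LIMSEQ_subseq_LIMSEQ[OF L r]] p
      by (simp add: weakly_convergent_to_iff_inner o_def)
    moreover have "q \<bullet> (q - p) = L"
      using LIMSEQ_unique[OF _ LIMSEQ_subseq_LIMSEQ[OF L s]] q
      by (simp add: weakly_convergent_to_iff_inner o_def)
    ultimately have "(q - p) \<bullet> (q - p) = 0" by (simp add: inner_diff_left)
    then show ?thesis by simp
  qed
  have "(\<lambda>n. X n \<bullet> v) \<longlonglongrightarrow> p \<bullet> v" for v
  proof (rule ccontr)
    assume "\<not> ?thesis"
    then obtain e where e: "0 < e" "\<exists>\<^sub>F n in sequentially. e \<le> dist (X n \<bullet> v) (p \<bullet> v)"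
      unfolding tendsto_iff by (auto simp: frequently_def not_le)
    have inf: "infinite {n. e \<le> dist (X n \<bullet> v) (p \<bullet> v)}"
      using e(2) by (simp add: frequently_cofinite flip: cofinite_eq_sequentially)
    define s where "s = enumerate {n. e \<le> dist (X n \<bullet> v) (p \<bullet> v)}"
    have s: "strict_mono s" "\<And>n. e \<le> dist (X (s n) \<bullet> v) (p \<bullet> v)"
      using strict_mono_enumerate[OF inf] enumerate_in_set[OF inf] by (auto simp: s_def)
    have "bounded (range (X \<circ> s))" using bX by (rule bounded_subset) auto
    then obtain s' q where s': "strict_mono s'" "weakly_convergent_to ((X \<circ> s) \<circ> s') q"
      using bounded_imp_weakly_convergent_subseq by blast
    have "q = p" using uniq[of "s \<circ> s'" q] s(1) s' by (simp add: strict_mono_o o_assoc)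
    then have "(\<lambda>n. X (s (s' n)) \<bullet> v) \<longlonglongrightarrow> p \<bullet> v"
      using s'(2) by (simp add: weakly_convergent_to_iff_inner)
    then have "\<forall>\<^sub>F n in sequentially. dist (X (s (s' n)) \<bullet> v) (p \<bullet> v) < e"
      using e(1) by (simp add: tendsto_iff)
    then show False using s(2) by (auto dest: eventually_happens simp: not_less[symmetric])
  qed
  then have "weakly_convergent_to X p" by (simp add: weakly_convergent_to_iff_inner)
  with pW that show ?thesis by blast
qed

section \<open>One step of the iteration\<close>

lemma argmin_prox_inequality:
  fixes C :: "'a::real_inner set"
  assumes "is_arg_min (\<lambda>v. l * h v + 1/2 * (norm (v - x))\<^sup>2) (\<lambda>v. v \<in> C) z"
    and "convex_on C h" "0 \<le> l" "v \<in> C"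
  shows "(x - z) \<bullet> (v - z) \<le> l * (h v - h z)"
  using prox_inequality[OF convex_on_cmul[OF assms(3,2)], of z v x] assms
  by (simp add: is_arg_min_linorder algebra_simps)

text \<open>
  A projection is the minimiser for \<open>h = 0\<close>, so its obtuse-angle property is
  \<open>prox_inequality\<close>.
\<close>

lemma metric_projection_dist_le:
  fixes C :: "'a::real_inner set"
  assumes "convex C" "is_metric_projection C v p" "w \<in> C"
  shows "(norm (p - w))\<^sup>2 \<le> (norm (v - w))\<^sup>2"
proof -
  have "norm (p - v) \<le> norm (y - v)" if "y \<in> C" for y
    using assms(2) that unfolding is_metric_projection_def by (metis norm_minus_commute)
  then have "(v - p) \<bullet> (w - p) \<le> 0"
    using prox_inequality[of C "\<lambda>_. 0" p w v] assms
    by (simp add: is_metric_projection_def convex_on_const power_mono)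
  moreover have "(norm (v - w))\<^sup>2 = (norm (v - p))\<^sup>2 + (norm (p - w))\<^sup>2 - 2 * ((v - p) \<bullet> (w - p))"
    by (simp add: power2_norm_eq_inner inner_diff inner_commute)
  ultimately show ?thesis by (smt (verit) zero_le_power2)
qed

text \<open>
  Test the optimality condition of \<open>z\<close> with \<open>w\<close> and that of \<open>y\<close> with \<open>z\<close>. Pseudomonotonicity
  discards \<open>f y w\<close>, and the Lipschitz-type condition trades \<open>f y z\<close> for \<open>f x z - f x y\<close> at the price
  of \<open>c1\<close> and \<open>c2\<close> times squared norms.
\<close>

lemma extragradient_step:
  assumes B: "assumptions_B C c1 c2 f" and x: "x \<in> C" and l: "0 < l"
    and y: "is_arg_min (\<lambda>v. l * f x v + 1/2 * (norm (v - x))\<^sup>2) (\<lambda>v. v \<in> C) y"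
    and z: "is_arg_min (\<lambda>v. l * f y v + 1/2 * (norm (v - x))\<^sup>2) (\<lambda>v. v \<in> C) z"
    and w: "w \<in> Sol C f"
  shows "(norm (z - w))\<^sup>2 \<le>
    (norm (x - w))\<^sup>2 - (1 - 2 * l * c1) * (norm (x - y))\<^sup>2 - (1 - 2 * l * c2) * (norm (y - z))\<^sup>2"
proof -
  have yC: "y \<in> C" and zC: "z \<in> C" and wC: "w \<in> C"
    using y z w by (auto simp: is_arg_min_def Sol_def)
  have fyw: "f y w \<le> 0"
    using B w yC wC by (auto simp: assumptions_B_def Sol_def)
  have lip: "f x z - f x y - c1 * (norm (x - y))\<^sup>2 - c2 * (norm (y - z))\<^sup>2 \<le> f y z"
    using B x yC zC by (force simp: assumptions_B_def lipschitz_type_on_def)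
  have "(x - z) \<bullet> (w - z) \<le> l * (f y w - f y z)"
    using argmin_prox_inequality[OF z _ _ wC] B l yC by (auto simp: assumptions_B_def)
  also have "\<dots> \<le> l * - (f x z - f x y - c1 * (norm (x - y))\<^sup>2 - c2 * (norm (y - z))\<^sup>2)"
    using fyw lip l by (intro mult_left_mono) auto
  also have "\<dots> = l * c1 * (norm (x - y))\<^sup>2 + l * c2 * (norm (y - z))\<^sup>2 - l * (f x z - f x y)"
    by (simp add: algebra_simps)
  also have "\<dots> \<le> l * c1 * (norm (x - y))\<^sup>2 + l * c2 * (norm (y - z))\<^sup>2 - (x - y) \<bullet> (z - y)"
    using argmin_prox_inequality[OF y _ _ zC] B l x by (auto simp: assumptions_B_def)
  finally have main: "(x - z) \<bullet> (w - z) \<le>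
    l * c1 * (norm (x - y))\<^sup>2 + l * c2 * (norm (y - z))\<^sup>2 - (x - y) \<bullet> (z - y)" .
  have e1: "2 * ((x - z) \<bullet> (w - z)) = (norm (x - z))\<^sup>2 + (norm (z - w))\<^sup>2 - (norm (x - w))\<^sup>2"
    by (simp add: power2_norm_eq_inner inner_diff inner_commute)
  have e2: "2 * ((x - y) \<bullet> (z - y)) = (norm (x - y))\<^sup>2 + (norm (y - z))\<^sup>2 - (norm (x - z))\<^sup>2"
    by (simp add: power2_norm_eq_inner inner_diff inner_commute)
  show ?thesis using main e1 e2 by (simp add: algebra_simps)
qed

text \<open>
  The squared norm of a convex combination falls short of the convex combination of the squared
  norms by \<open>\<alpha> * (1 - \<alpha>)\<close> times the squared distance of the two points; this deficit is the gain.
\<close>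

lemma averaged_step:
  fixes C :: "'a::real_inner set"
  assumes S: "nonexpansive_on C S" and z: "z \<in> C" and w: "w \<in> Fix C S" and \<alpha>: "0 \<le> \<alpha>"
  shows "(norm ((1 - \<alpha>) *\<^sub>R z + \<alpha> *\<^sub>R S z - w))\<^sup>2 \<le>
    (norm (z - w))\<^sup>2 - \<alpha> * (1 - \<alpha>) * (norm (z - S z))\<^sup>2"
proof -
  have "norm (S z - w) \<le> norm (z - w)"
    using S z w unfolding nonexpansive_on_def Fix_def by fastforce
  then have "(norm (S z - w))\<^sup>2 \<le> (norm (z - w))\<^sup>2" by (intro power_mono) auto
  then have "\<alpha> * (norm (S z - w))\<^sup>2 \<le> \<alpha> * (norm (z - w))\<^sup>2" by (rule mult_left_mono[OF _ \<alpha>])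
  moreover have "(norm ((1 - \<alpha>) *\<^sub>R p + \<alpha> *\<^sub>R q))\<^sup>2 =
    (1 - \<alpha>) * (norm p)\<^sup>2 + \<alpha> * (norm q)\<^sup>2 - \<alpha> * (1 - \<alpha>) * (norm (p - q))\<^sup>2" for p q :: 'a
    unfolding power2_norm_eq_inner
    by (simp add: inner_add_left inner_add_right inner_diff_left inner_diff_right inner_commute[of q p] field_simps)
  from this[of "z - w" "S z - w"]
  have "(norm ((1 - \<alpha>) *\<^sub>R z + \<alpha> *\<^sub>R S z - w))\<^sup>2 =
    (1 - \<alpha>) * (norm (z - w))\<^sup>2 + \<alpha> * (norm (S z - w))\<^sup>2 - \<alpha> * (1 - \<alpha>) * (norm (z - S z))\<^sup>2"
    by (simp add: algebra_simps)
  ultimately show ?thesis by (simp add: algebra_simps)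
qed

text \<open>
  Monotonicity gives \<open>g u w \<le> 0\<close>, so the resolvent inequality tested with \<open>w\<close> says that the
  angle at \<open>u\<close> between \<open>w\<close> and \<open>v\<close> is not acute.
\<close>

lemma resolvent_step:
  assumes g: "assumptions_A Q g" and u: "is_resolvent Q g r v u" and r: "0 < r" and w: "w \<in> Sol Q g"
  shows "(norm (u - w))\<^sup>2 \<le> (norm (v - w))\<^sup>2 - (norm (u - v))\<^sup>2"
proof -
  have uQ: "u \<in> Q" and wQ: "w \<in> Q" using u w by (auto simp: is_resolvent_def Sol_def)
  have "g u w + g w u \<le> 0" "0 \<le> g w u"
    using g w uQ wQ by (auto simp: assumptions_A_def Sol_def)
  moreover have "0 \<le> g u w + (1 / r) * ((w - u) \<bullet> (u - v))"
    using u wQ by (auto simp: is_resolvent_def)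
  ultimately have "0 \<le> (1 / r) * ((w - u) \<bullet> (u - v))" by linarith
  then have "0 \<le> (w - u) \<bullet> (u - v)" using r by (simp add: zero_le_divide_iff)
  moreover have "(norm (v - w))\<^sup>2 = (norm (u - w))\<^sup>2 + (norm (u - v))\<^sup>2 + 2 * ((w - u) \<bullet> (u - v))"
    by (simp add: power2_norm_eq_inner inner_diff inner_commute)
  ultimately show ?thesis by linarith
qed

text \<open>
  A gradient step for the defect \<open>T u - A t\<close>. The cross term \<open>(t - w) \<bullet> adjoint A (T u - A t)\<close>
  moves to the image space, where nonexpansiveness of \<open>T\<close> and the gain of the resolvent (hypothesis
  \<open>u\<close>) bound it above by minus half the two squared residuals; the quadratic term costs at most
  \<open>\<mu>\<^sup>2 * (onorm A)\<^sup>2\<close> times the first of them.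
\<close>

lemma split_correction_step:
  fixes A :: "'a::{real_inner, complete_space} \<Rightarrow> 'b::real_inner"
  assumes A: "bounded_linear A" and C: "convex C" "w \<in> C" and \<mu>: "0 < \<mu>"
    and T: "nonexpansive_on Q T" "A w \<in> Fix Q T" "u \<in> Q"
    and u: "(norm (u - A w))\<^sup>2 \<le> (norm (A t - A w))\<^sup>2 - (norm (u - A t))\<^sup>2"
    and x': "is_metric_projection C (t + \<mu> *\<^sub>R adjoint A (T u - A t)) x'"
  shows "(norm (x' - w))\<^sup>2 \<le> (norm (t - w))\<^sup>2
    - \<mu> * (1 - \<mu> * (onorm A)\<^sup>2) * (norm (T u - A t))\<^sup>2 - \<mu> * (norm (u - A t))\<^sup>2"
proof -
  let ?d = "T u - A t" and ?h = "adjoint A (T u - A t)"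
  have "norm (T u - A w) \<le> norm (u - A w)"
    using T unfolding nonexpansive_on_def Fix_def by fastforce
  then have "(norm (T u - A w))\<^sup>2 \<le> (norm (u - A w))\<^sup>2" by (intro power_mono) auto
  moreover have "2 * ((A t - A w) \<bullet> ?d) = (norm (T u - A w))\<^sup>2 - (norm (A t - A w))\<^sup>2 - (norm ?d)\<^sup>2"
    by (simp add: power2_norm_eq_inner inner_diff inner_commute)
  ultimately have "2 * ((A t - A w) \<bullet> ?d) \<le> - (norm (u - A t))\<^sup>2 - (norm ?d)\<^sup>2" using u by linarith
  moreover have "(A t - A w) \<bullet> ?d = (t - w) \<bullet> ?h"
    using inner_adjoint[OF A, of "t - w" ?d] A by (simp add: bounded_linear.linear linear_diff)
  ultimately have "2 * ((t - w) \<bullet> ?h) \<le> - (norm (u - A t))\<^sup>2 - (norm ?d)\<^sup>2" by simp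
  then have cross: "\<mu> * (2 * ((t - w) \<bullet> ?h)) \<le> \<mu> * (- (norm (u - A t))\<^sup>2 - (norm ?d)\<^sup>2)"
    using \<mu> by (intro mult_left_mono) auto
  have "(norm ?h)\<^sup>2 \<le> (onorm A * norm ?d)\<^sup>2" by (intro power_mono norm_adjoint_le A) auto
  then have quad: "\<mu>\<^sup>2 * (norm ?h)\<^sup>2 \<le> \<mu>\<^sup>2 * ((onorm A)\<^sup>2 * (norm ?d)\<^sup>2)"
    by (intro mult_left_mono) (auto simp: power_mult_distrib)
  have "(norm (x' - w))\<^sup>2 \<le> (norm (t + \<mu> *\<^sub>R ?h - w))\<^sup>2"
    by (rule metric_projection_dist_le[OF C(1) x' C(2)])
  also have "\<dots> = (norm (t - w))\<^sup>2 + \<mu> * (2 * ((t - w) \<bullet> ?h)) + \<mu>\<^sup>2 * (norm ?h)\<^sup>2"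
    unfolding power2_norm_eq_inner by (simp add: inner_commute algebra_simps power2_eq_square)
  finally show ?thesis using cross quad by (simp add: algebra_simps power2_eq_square)
qed

section \<open>Weak limits solve the equilibrium problems\<close>

lemma tendsto_inner_bounded_zero:
  fixes D V :: "nat \<Rightarrow> 'a::real_inner"
  assumes D: "D \<longlonglongrightarrow> 0" and V: "bounded (range V)"
  shows "(\<lambda>n. D n \<bullet> V n) \<longlonglongrightarrow> 0"
proof -
  obtain K where K: "\<And>n. norm (V n) \<le> K" using V by (auto simp: bounded_iff)
  show ?thesis
  proof (rule Lim_null_comparison)
    have "norm (D n \<bullet> V n) \<le> norm (D n) * K" for n
      using Cauchy_Schwarz_ineq2[of "D n" "V n"] mult_left_mono[OF K[of n], of "norm (D n)"] by simp
    then show "\<forall>\<^sub>F n in sequentially. norm (D n \<bullet> V n) \<le> norm (D n) * K" by simp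
    show "(\<lambda>n. norm (D n) * K) \<longlonglongrightarrow> 0"
      using tendsto_mult_left_zero[OF tendsto_norm_zero[OF D]] .
  qed
qed

lemma bounded_range_const_minus:
  "bounded (range V) \<Longrightarrow> bounded (range (\<lambda>n. c - V n))"
  for V :: "nat \<Rightarrow> 'a::real_normed_vector"
proof -
  assume "bounded (range V)"
  then obtain K where "\<And>n. norm (V n) \<le> K" by (auto simp: bounded_iff)
  then have "norm (c - V n) \<le> norm c + K" for n using norm_triangle_ineq4[of c "V n"] by (smt (verit))
  then show ?thesis by (auto simp: bounded_iff)
qed

lemma bounded_range_perturb:
  fixes X Y :: "nat \<Rightarrow> 'a::real_normed_vector"
  assumes "bounded (range X)" "(\<lambda>n. Y n - X n) \<longlonglongrightarrow> 0"
  shows "bounded (range Y)"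
proof -
  have "bounded (range (\<lambda>n. Y n - X n))" using assms(2) by (rule convergent_imp_bounded)
  with assms(1) have "bounded ((\<lambda>(a, b). a + b) ` (range X \<times> range (\<lambda>n. Y n - X n)))"
    by (rule bounded_plus)
  moreover have "Y n \<in> (\<lambda>(a, b). a + b) ` (range X \<times> range (\<lambda>n. Y n - X n))" for n
    by (rule image_eqI[of _ _ "(X n, Y n - X n)"]) auto
  ultimately show ?thesis by (auto intro: bounded_subset)
qed

text \<open>
  The optimality condition of \<open>Y n\<close> tested with \<open>v\<close> bounds \<open>f (X n) v - f (X n) (Y n)\<close> below by
  a vanishing inner product divided by a step size that stays away from 0, while the expression
  itself tends to \<open>f p v - f p p = f p v\<close>.
\<close>

lemma weak_limit_of_prox_steps_in_Sol:
  fixes C :: "'a::{real_inner, complete_space} set"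
  assumes C: "closed C" "convex C" and B: "assumptions_B C c1 c2 f"
    and X: "\<And>n. X n \<in> C" "weakly_convergent_to X p"
    and Y: "weakly_convergent_to Y p" "bounded (range Y)" "(\<lambda>n. X n - Y n) \<longlonglongrightarrow> 0"
    and l: "0 < a" "\<And>n. a \<le> l n"
    and prox: "\<And>n. is_arg_min (\<lambda>v. l n * f (X n) v + 1/2 * (norm (v - X n))\<^sup>2) (\<lambda>v. v \<in> C) (Y n)"
  shows "p \<in> Sol C f"
proof -
  have p: "p \<in> C" using weak_limit_in_closed_convex[OF C X(2)] X(1) by simp
  have YC: "Y n \<in> C" for n using prox[of n] by (simp add: is_arg_min_def)
  have "0 \<le> f p v" if v: "v \<in> C" for v
  proof -
    have cont: "(\<lambda>n. f (X n) (Y' n)) \<longlonglongrightarrow> f p q"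
      if "\<And>n. Y' n \<in> C" "q \<in> C" "weakly_convergent_to Y' q" for Y' q
      using B p that X unfolding assumptions_B_def jointly_weakly_continuous_on_def by blast
    have "weakly_convergent_to (\<lambda>_. v) v" by (simp add: weakly_convergent_to_def)
    then have "(\<lambda>n. f (X n) v - f (X n) (Y n)) \<longlonglongrightarrow> f p v - f p p"
      by (intro tendsto_diff cont YC p v Y)
    moreover have "f p p = 0" using B p by (simp add: assumptions_B_def)
    ultimately have lim: "(\<lambda>n. f (X n) v - f (X n) (Y n)) \<longlonglongrightarrow> f p v" by simp
    have "- \<bar>(X n - Y n) \<bullet> (v - Y n)\<bar> / a \<le> f (X n) v - f (X n) (Y n)" for n
    proof -
      let ?D = "f (X n) v - f (X n) (Y n)" and ?i = "(X n - Y n) \<bullet> (v - Y n)"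
      have "convex_on C (f (X n))" using B X(1) by (simp add: assumptions_B_def)
      moreover have ln: "0 < l n" "a \<le> l n" using l(1) l(2)[of n] by auto
      ultimately have "?i \<le> l n * ?D"
        using argmin_prox_inequality[OF prox _ _ v] by simp
      show ?thesis
      proof (cases "0 \<le> ?D")
        case True
        have "- \<bar>?i\<bar> / a \<le> 0" using l(1) by simp
        with True show ?thesis by linarith
      next
        case False
        then have "l n * ?D \<le> a * ?D" using ln by (simp add: mult_right_mono_neg)
        then have "- \<bar>?i\<bar> \<le> ?D * a" using \<open>?i \<le> l n * ?D\<close> by (simp add: mult.commute)
        then show ?thesis using pos_divide_le_eq[OF l(1), of "- \<bar>?i\<bar>" ?D] by blast
      qed
    qed
    moreover have "(\<lambda>n. - \<bar>(X n - Y n) \<bullet> (v - Y n)\<bar> / a) \<longlonglongrightarrow> - \<bar>0\<bar> / a"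
      using l(1) by (intro tendsto_intros tendsto_inner_bounded_zero Y bounded_range_const_minus) auto
    ultimately have "- \<bar>0\<bar> / a \<le> f p v" using lim
      by (intro LIMSEQ_le[of _ _ "\<lambda>n. f (X n) v - f (X n) (Y n)"]) auto
    then show ?thesis by simp
  qed
  then show ?thesis using p by (simp add: Sol_def)
qed

text \<open>
  On the segment from \<open>p\<close> to \<open>v\<close> convexity and \<open>g w w = 0\<close> turn the dual inequality at \<open>w\<close> into
  \<open>0 \<le> g w v\<close>; hemicontinuity carries this to the end point \<open>p\<close>.
\<close>

lemma minty:
  assumes Q: "convex Q" and g: "assumptions_A Q g" and p: "p \<in> Q"
    and dual: "\<And>v. v \<in> Q \<Longrightarrow> g v p \<le> 0"
  shows "p \<in> Sol Q g"
proof -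
  have "0 \<le> g p v" if v: "v \<in> Q" for v
  proof -
    let ?w = "\<lambda>s. s *\<^sub>R v + (1 - s) *\<^sub>R p"
    have pos: "0 \<le> g (?w s) v" if s: "0 < s" "s < 1" for s :: real
    proof -
      have w: "?w s \<in> Q" using Q v p s by (simp add: convexD)
      have conv: "convex_on Q (g (?w s))" and z: "g (?w s) (?w s) = 0"
        using g w by (auto simp: assumptions_A_def)
      have "0 \<le> (1 - s) * g (?w s) p + s * g (?w s) v"
        using convex_onD[OF conv, of s p v] s p v z by (simp add: add.commute)
      moreover have "(1 - s) * g (?w s) p \<le> 0"
        using dual[OF w] s by (simp add: mult_nonneg_nonpos)
      ultimately have "0 \<le> s * g (?w s) v" by linarith
      then show ?thesis using s by (simp add: zero_le_mult_iff)
    qed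
    have ev: "\<forall>\<^sub>F s in at_right 0. ereal 0 \<le> ereal (g (?w s) v)"
      unfolding eventually_at_right_field using pos by (intro exI[of _ 1]) simp
    have "ereal 0 \<le> Limsup (at_right 0) (\<lambda>s. ereal (g (?w s) v))"
      by (rule le_Limsup[OF _ ev]) simp
    also have "\<dots> \<le> ereal (g p v)" using g p v unfolding assumptions_A_def by blast
    finally show ?thesis by simp
  qed
  then show ?thesis using p by (simp add: Sol_def)
qed

lemma closed_sublevel_lsc_on:
  fixes Q :: "'a::metric_space set"
  assumes Q: "closed Q" and h: "lsc_on Q h"
  shows "closed {x \<in> Q. h x \<le> e}"
  unfolding closed_sequential_limits
proof (intro allI impI, elim conjE)
  fix X x assume X: "\<forall>n. X n \<in> {x \<in> Q. h x \<le> e}" and x: "X \<longlonglongrightarrow> x"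
  have xQ: "x \<in> Q" using closed_sequentially[OF Q _ x] X by simp
  have "h x \<le> e"
  proof (rule ccontr)
    assume "\<not> h x \<le> e"
    then have "ereal e < Liminf (at x within Q) (\<lambda>y. ereal (h y))"
      using h xQ unfolding lsc_on_def by (meson ereal_less_eq(3) less_le_trans not_le)
    from less_LiminfD[OF this] obtain U where U: "open U" "x \<in> U" "\<And>y. y \<in> U \<Longrightarrow> y \<noteq> x \<Longrightarrow> y \<in> Q \<Longrightarrow> e < h y"
      unfolding eventually_at_topological by auto
    have "\<forall>\<^sub>F n in sequentially. X n \<in> U" using topological_tendstoD[OF x U(1,2)] .
    then obtain n where n: "X n \<in> U" by (auto dest: eventually_happens)
    then show False using U(3)[of "X n"] X \<open>\<not> h x \<le> e\<close> by (metis (no_types, lifting) mem_Collect_eq not_le)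
  qed
  then show "x \<in> {x \<in> Q. h x \<le> e}" using xQ by simp
qed

text \<open>
  Monotonicity turns the resolvent inequality into an upper bound on \<open>g v (U n)\<close> that tends to 0.
  In this form the iterate stands in the convex, lower semicontinuous argument, whose sublevel sets are
  weakly closed, so the weak limit satisfies \<open>g v q \<le> 0\<close> and \<open>minty\<close> applies.
\<close>

lemma weak_limit_of_resolvents_in_Sol:
  fixes Q :: "'b::{real_inner, complete_space} set"
  assumes Q: "closed Q" "convex Q" and g: "assumptions_A Q g"
    and U: "\<And>n. is_resolvent Q g (r n) (V n) (U n)" "weakly_convergent_to U q" "bounded (range U)"
    and d: "(\<lambda>n. U n - V n) \<longlonglongrightarrow> 0"
    and r: "0 < c" "\<forall>\<^sub>F n in sequentially. c \<le> r n"
  shows "q \<in> Sol Q g"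
proof (rule minty[OF Q(2) g])
  have UQ: "U n \<in> Q" for n using U(1)[of n] by (simp add: is_resolvent_def)
  show "q \<in> Q" using weak_limit_in_closed_convex[OF Q U(2)] UQ by simp
  fix v assume v: "v \<in> Q"
  have conv: "convex_on Q (g v)" and lsc: "lsc_on Q (g v)" using g v by (auto simp: assumptions_A_def)
  let ?i = "\<lambda>n. (U n - V n) \<bullet> (v - U n)"
  have i: "(\<lambda>n. \<bar>?i n\<bar> / c) \<longlonglongrightarrow> \<bar>0\<bar> / c"
    using r(1) by (intro tendsto_intros tendsto_inner_bounded_zero d U bounded_range_const_minus) auto
  have "g v q \<le> 0 + e" if e: "0 < e" for e
  proof -
    have "\<forall>\<^sub>F n in sequentially. \<bar>?i n\<bar> / c < e"
      using order_tendstoD(2)[OF i, of e] e by simp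
    then have "\<forall>\<^sub>F n in sequentially. U n \<in> {x \<in> Q. g v x \<le> e}"
      using r(2)
    proof eventually_elim
      case (elim n)
      have "0 \<le> g (U n) v + (1 / r n) * ((v - U n) \<bullet> (U n - V n))"
        using U(1)[of n] v by (simp add: is_resolvent_def)
      moreover have "g (U n) v + g v (U n) \<le> 0" using g v UQ by (simp add: assumptions_A_def)
      moreover have "(1 / r n) * ((v - U n) \<bullet> (U n - V n)) \<le> \<bar>?i n\<bar> / c"
      proof -
        have "(1 / r n) * ((v - U n) \<bullet> (U n - V n)) \<le> (1 / r n) * \<bar>?i n\<bar>"
          using elim r(1) by (intro mult_left_mono) (auto simp: inner_commute)
        also have "\<dots> \<le> (1 / c) * \<bar>?i n\<bar>"
          using elim r(1) by (intro mult_right_mono) (auto simp: frac_le)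
        finally show ?thesis by simp
      qed
      ultimately show ?case using elim UQ by simp
    qed
    moreover have "closed {x \<in> Q. g v x \<le> e}" by (rule closed_sublevel_lsc_on[OF Q(1) lsc])
    moreover have "convex {x \<in> Q. g v x \<le> e}"
    proof (rule convexI)
      fix x y and s t :: real
      assume "x \<in> {x \<in> Q. g v x \<le> e}" "y \<in> {x \<in> Q. g v x \<le> e}" "0 \<le> s" "0 \<le> t" "s + t = 1"
      then show "s *\<^sub>R x + t *\<^sub>R y \<in> {x \<in> Q. g v x \<le> e}"
        using convex_lower[OF conv, of x y s t] convexD[OF Q(2), of x y s t] by auto
    qed
    ultimately have "q \<in> {x \<in> Q. g v x \<le> e}" using weak_limit_in_closed_convex U(2) by blast
    then show ?thesis by simp
  qed
  then show "g v q \<le> 0" by (rule field_le_epsilon)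
qed

section \<open>Convergence\<close>

text \<open>
  The gains \<open>e n\<close> are squeezed between 0 and the increments of a convergent sequence.
\<close>

lemma convergent_and_gain_vanishes:
  fixes a e :: "nat \<Rightarrow> real"
  assumes step: "\<And>n. a (Suc n) \<le> a n - e n" and nn: "\<And>n. 0 \<le> a n" "\<And>n. 0 \<le> e n"
  shows "convergent a" "e \<longlonglongrightarrow> 0"
proof -
  have "a (Suc n) \<le> a n" for n using step[of n] nn(2)[of n] by simp
  then have "decseq a" by (simp add: decseq_Suc_iff)
  then obtain L where L: "a \<longlonglongrightarrow> L" using decseq_convergent[of a 0] nn(1) by blast
  then show "convergent a" by (auto simp: convergent_def)
  have lim: "(\<lambda>n. a n - a (Suc n)) \<longlonglongrightarrow> 0" using tendsto_diff[OF L LIMSEQ_Suc[OF L]] by simp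
  have le: "e n \<le> a n - a (Suc n)" for n using step[of n] by simp
  show "e \<longlonglongrightarrow> 0"
    by (rule tendsto_sandwich[OF _ _ tendsto_const lim]) (simp_all add: nn le)
qed

lemma tendsto_zero_of_sq_dominated:
  fixes V :: "nat \<Rightarrow> 'a::real_normed_vector"
  assumes "0 < c" "\<And>n. c * (norm (V n))\<^sup>2 \<le> e n" "e \<longlonglongrightarrow> 0"
  shows "V \<longlonglongrightarrow> 0"
proof -
  have "(\<lambda>n. (norm (V n))\<^sup>2) \<longlonglongrightarrow> 0"
  proof (rule tendsto_sandwich[where f="\<lambda>_. 0" and h="\<lambda>n. e n / c"])
    show "(\<lambda>n. e n / c) \<longlonglongrightarrow> 0" using tendsto_divide[OF assms(3) tendsto_const[of c]] assms(1) by simp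
    have "(norm (V n))\<^sup>2 \<le> e n / c" for n
      using assms(1) assms(2)[of n] by (simp add: pos_le_divide_eq mult.commute)
    then show "\<forall>\<^sub>F n in sequentially. (norm (V n))\<^sup>2 \<le> e n / c" by simp
  qed auto
  then have "(\<lambda>n. sqrt ((norm (V n))\<^sup>2)) \<longlonglongrightarrow> sqrt 0" by (rule tendsto_real_sqrt)
  then show ?thesis by (simp add: tendsto_norm_zero_iff)
qed

theorem theorem1:
  fixes C :: "'a::{real_inner, complete_space} set"
    and Q :: "'b::{real_inner, complete_space} set"
    and S :: "'a \<Rightarrow> 'a" and T :: "'b \<Rightarrow> 'b"
    and f :: "'a \<Rightarrow> 'a \<Rightarrow> real" and g :: "'b \<Rightarrow> 'b \<Rightarrow> real"
    and A :: "'a \<Rightarrow> 'b"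
    and c1 c2 a b \<alpha> \<mu> :: real
    and lam \<alpha>s :: "nat \<Rightarrow> real"
    and x y z t :: "nat \<Rightarrow> 'a" and u :: "nat \<Rightarrow> 'b"
    and \<Omega> :: "'a set"
  assumes C: "C \<noteq> {}" "closed C" "convex C"
    and Q: "Q \<noteq> {}" "closed Q" "convex Q"
    and S: "nonexpansive_on C S"
    and T: "nonexpansive_on Q T"
    and g: "assumptions_A Q g"
    and f: "assumptions_B C c1 c2 f"
    and A: "bounded_linear A"
    and ab: "a \<in> {0<..<min (1 / (2 * c1)) (1 / (2 * c2))}"
            "b \<in> {0<..<min (1 / (2 * c1)) (1 / (2 * c2))}"
    and lam: "\<forall>k\<ge>1. lam k \<in> {a..b}"
    and \<alpha>: "0 < \<alpha>" "\<alpha> < 1"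
    and \<mu>: "0 < \<mu>" "ereal \<mu> < 1 / ereal ((onorm A)\<^sup>2)"
    and \<alpha>s: "\<forall>k\<ge>1. \<alpha>s k > 0" "liminf (\<lambda>k. ereal (\<alpha>s k)) > 0"
    and x1: "x 1 \<in> C"
    and y: "\<forall>k\<ge>1. is_arg_min (\<lambda>v. lam k * f (x k) v + 1/2 * (norm (v - x k))\<^sup>2) (\<lambda>v. v \<in> C) (y k)"
    and z: "\<forall>k\<ge>1. is_arg_min (\<lambda>v. lam k * f (y k) v + 1/2 * (norm (v - x k))\<^sup>2) (\<lambda>v. v \<in> C) (z k)"
    and t: "\<forall>k\<ge>1. t k = (1 - \<alpha>) *\<^sub>R z k + \<alpha> *\<^sub>R S (z k)"
    and u: "\<forall>k\<ge>1. is_resolvent Q g (\<alpha>s k) (A (t k)) (u k)"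
    and xSuc: "\<forall>k\<ge>1. is_metric_projection C
                 (t k + \<mu> *\<^sub>R adjoint A (T (u k) - A (t k))) (x (k + 1))"
    and \<Omega>: "\<Omega> = {xs \<in> Sol C f \<inter> Fix C S. A xs \<in> Sol Q g \<inter> Fix Q T}"
    and ne: "\<Omega> \<noteq> {}"
  shows "\<exists>p\<in>\<Omega>. weakly_convergent_to x p \<and> weakly_convergent_to z p \<and>
           weakly_convergent_to u (A p) \<and> A p \<in> Sol Q g \<inter> Fix Q T"
proof -
  \<comment> \<open>The recursion constrains indices from 1 on only, so every sequence is shifted by one; then each
    property holds for all indices, and weak limits are not affected.\<close>
  define X Y Z U where "X n = x (Suc n)" and "Y n = y (Suc n)" and "Z n = z (Suc n)" and "U n = u (Suc n)" for n
  define L R where "L n = lam (Suc n)" and "R n = \<alpha>s (Suc n)" for n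
  define V where "V n = (1 - \<alpha>) *\<^sub>R Z n + \<alpha> *\<^sub>R S (Z n)" for n
  note defs = X_def Y_def Z_def U_def L_def R_def V_def
  have t_eq: "t (Suc n) = V n" for n using t by (simp add: defs)
  have Yn: "is_arg_min (\<lambda>v. L n * f (X n) v + 1/2 * (norm (v - X n))\<^sup>2) (\<lambda>v. v \<in> C) (Y n)" for n
    using y by (simp add: defs)
  have Zn: "is_arg_min (\<lambda>v. L n * f (Y n) v + 1/2 * (norm (v - X n))\<^sup>2) (\<lambda>v. v \<in> C) (Z n)" for n
    using z by (simp add: defs)
  have Un: "is_resolvent Q g (R n) (A (V n)) (U n)" for n
    using u[rule_format, of "Suc n"] t_eq[of n] by (simp add: U_def R_def)
  have XSuc: "is_metric_projection C (V n + \<mu> *\<^sub>R adjoint A (T (U n) - A (V n))) (X (Suc n))" for n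
    using xSuc[rule_format, of "Suc n"] t_eq[of n] by (simp add: X_def U_def)
  have XC: "X n \<in> C" for n
    using x1 XSuc by (cases n) (auto simp: X_def is_metric_projection_def)
  have ZC: "Z n \<in> C" and UQ: "U n \<in> Q" for n
    using Zn[of n] Un[of n] by (auto simp: is_arg_min_def is_resolvent_def)
  have L: "a \<le> L n" "L n \<le> b" and R: "0 < R n" for n
    using lam \<alpha>s(1) by (auto simp: L_def R_def)
  have a: "0 < a" using ab(1) by simp
  have c: "0 < c1" "0 < c2" using f by (auto simp: assumptions_B_def)
  then have b: "0 < 1 - 2 * b * c1" "0 < 1 - 2 * b * c2"
    using ab(2) by (auto simp: field_simps)
  \<comment> \<open>For \<open>A = 0\<close> the upper bound on \<open>\<mu>\<close> is infinite, so this case is separate.\<close>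
  have \<mu>A: "0 < 1 - \<mu> * (onorm A)\<^sup>2"
  proof (cases "onorm A = 0")
    case False
    then have "0 < (onorm A)\<^sup>2" by simp
    moreover have "\<mu> < 1 / (onorm A)\<^sup>2" using \<mu>(2) False by (simp add: one_ereal_def)
    ultimately show ?thesis by (simp add: field_simps)
  qed simp
  \<comment> \<open>The total gain of one iteration, with \<open>b\<close> in place of the step size to make the coefficients
    constant.\<close>
  define E where "E n = (1 - 2 * b * c1) * (norm (X n - Y n))\<^sup>2 + (1 - 2 * b * c2) * (norm (Y n - Z n))\<^sup>2
    + \<alpha> * (1 - \<alpha>) * (norm (Z n - S (Z n)))\<^sup>2
    + \<mu> * (1 - \<mu> * (onorm A)\<^sup>2) * (norm (T (U n) - A (V n)))\<^sup>2 + \<mu> * (norm (U n - A (V n)))\<^sup>2" for n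
  have nonneg: "0 \<le> (1 - 2 * b * c1) * (norm (X n - Y n))\<^sup>2" "0 \<le> (1 - 2 * b * c2) * (norm (Y n - Z n))\<^sup>2"
    "0 \<le> \<alpha> * (1 - \<alpha>) * (norm (Z n - S (Z n)))\<^sup>2"
    "0 \<le> \<mu> * (1 - \<mu> * (onorm A)\<^sup>2) * (norm (T (U n) - A (V n)))\<^sup>2" "0 \<le> \<mu> * (norm (U n - A (V n)))\<^sup>2" for n
    using b \<alpha> \<mu>(1) \<mu>A by (auto intro!: mult_nonneg_nonneg)
  have E_nonneg: "0 \<le> E n" for n using nonneg[of n] by (simp add: E_def)
  have step: "(norm (X (Suc n) - w))\<^sup>2 \<le> (norm (X n - w))\<^sup>2 - E n" if w: "w \<in> \<Omega>" for w n
  proof -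
    have w': "w \<in> Sol C f" "w \<in> Fix C S" "A w \<in> Sol Q g" "A w \<in> Fix Q T" "w \<in> C"
      using w by (auto simp: \<Omega> Sol_def)
    have "(1 - 2 * b * c1) * (norm (X n - Y n))\<^sup>2 \<le> (1 - 2 * L n * c1) * (norm (X n - Y n))\<^sup>2"
      "(1 - 2 * b * c2) * (norm (Y n - Z n))\<^sup>2 \<le> (1 - 2 * L n * c2) * (norm (Y n - Z n))\<^sup>2"
      using L(2)[of n] c by (auto intro!: mult_right_mono)
    moreover have "(norm (Z n - w))\<^sup>2 \<le> (norm (X n - w))\<^sup>2
        - (1 - 2 * L n * c1) * (norm (X n - Y n))\<^sup>2 - (1 - 2 * L n * c2) * (norm (Y n - Z n))\<^sup>2"
      using extragradient_step[OF f XC _ Yn Zn w'(1)] L(1)[of n] a by simp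
    moreover have "(norm (V n - w))\<^sup>2 \<le> (norm (Z n - w))\<^sup>2 - \<alpha> * (1 - \<alpha>) * (norm (Z n - S (Z n)))\<^sup>2"
      unfolding V_def by (rule averaged_step[OF S ZC w'(2)]) (use \<alpha> in simp)
    moreover have "(norm (X (Suc n) - w))\<^sup>2 \<le> (norm (V n - w))\<^sup>2
        - \<mu> * (1 - \<mu> * (onorm A)\<^sup>2) * (norm (T (U n) - A (V n)))\<^sup>2 - \<mu> * (norm (U n - A (V n)))\<^sup>2"
      by (rule split_correction_step[OF A C(3) w'(5) \<mu>(1) T w'(4) UQ
            resolvent_step[OF g Un R w'(3)] XSuc])
    ultimately show ?thesis unfolding E_def by linarith
  qed
  have fejer: "convergent (\<lambda>n. norm (X n - w))" and E0: "E \<longlonglongrightarrow> 0" if w: "w \<in> \<Omega>" for w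
  proof -
    note d = convergent_and_gain_vanishes[of "\<lambda>n. (norm (X n - w))\<^sup>2" E, OF step[OF w] zero_le_power2 E_nonneg]
    then obtain l where "(\<lambda>n. (norm (X n - w))\<^sup>2) \<longlonglongrightarrow> l" by (auto simp: convergent_def)
    then have "(\<lambda>n. sqrt ((norm (X n - w))\<^sup>2)) \<longlonglongrightarrow> sqrt l" by (rule tendsto_real_sqrt)
    then show "convergent (\<lambda>n. norm (X n - w))" by (auto simp: convergent_def)
    show "E \<longlonglongrightarrow> 0" using d by blast
  qed
  obtain w0 where w0: "w0 \<in> \<Omega>" using ne by blast
  have bX: "bounded (range X)"
  proof -
    obtain K where "\<And>n. norm (norm (X n - w0)) \<le> K"
      using convergent_imp_Bseq[OF fejer[OF w0]] unfolding Bseq_def by blast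
    then have "norm (X n) \<le> norm w0 + K" for n
      using norm_triangle_sub[of "X n" w0] by (force intro: order_trans)
    then show ?thesis by (auto simp: bounded_iff)
  qed
  have XY: "(\<lambda>n. X n - Y n) \<longlonglongrightarrow> 0"
    by (rule tendsto_zero_of_sq_dominated[OF b(1) _ E0[OF w0]]) (simp add: E_def add_nonneg_nonneg nonneg)
  have YZ: "(\<lambda>n. Y n - Z n) \<longlonglongrightarrow> 0"
    by (rule tendsto_zero_of_sq_dominated[OF b(2) _ E0[OF w0]]) (simp add: E_def add_nonneg_nonneg nonneg)
  have ZS: "(\<lambda>n. Z n - S (Z n)) \<longlonglongrightarrow> 0"
    by (rule tendsto_zero_of_sq_dominated[of "\<alpha> * (1 - \<alpha>)", OF _ _ E0[OF w0]])
      (use \<alpha> in \<open>simp_all add: E_def add_nonneg_nonneg nonneg\<close>)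
  have TU: "(\<lambda>n. T (U n) - A (V n)) \<longlonglongrightarrow> 0"
    by (rule tendsto_zero_of_sq_dominated[of "\<mu> * (1 - \<mu> * (onorm A)\<^sup>2)", OF _ _ E0[OF w0]])
      (use \<mu>(1) \<mu>A in \<open>simp_all add: E_def add_nonneg_nonneg nonneg\<close>)
  have UA: "(\<lambda>n. U n - A (V n)) \<longlonglongrightarrow> 0"
    by (rule tendsto_zero_of_sq_dominated[OF \<mu>(1) _ E0[OF w0]]) (simp add: E_def add_nonneg_nonneg nonneg)
  have YX: "(\<lambda>n. Y n - X n) \<longlonglongrightarrow> 0" using tendsto_minus[OF XY] by simp
  have ZX: "(\<lambda>n. Z n - X n) \<longlonglongrightarrow> 0" using tendsto_minus[OF tendsto_add[OF XY YZ]] by simp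
  have VX: "(\<lambda>n. V n - X n) \<longlonglongrightarrow> 0"
  proof -
    have "(\<lambda>n. (Z n - X n) - \<alpha> *\<^sub>R (Z n - S (Z n))) \<longlonglongrightarrow> 0 - \<alpha> *\<^sub>R 0" by (intro tendsto_intros ZX ZS)
    then show ?thesis by (simp add: V_def algebra_simps)
  qed
  have UAX: "(\<lambda>n. U n - A (X n)) \<longlonglongrightarrow> 0"
    using tendsto_add[OF UA bounded_linear.tendsto[OF A VX]] A
    by (simp add: bounded_linear.linear linear_diff linear_0)
  have UT: "(\<lambda>n. U n - T (U n)) \<longlonglongrightarrow> 0" using tendsto_diff[OF UA TU] by simp
  have bY: "bounded (range Y)" and bZ: "bounded (range Z)"
    using bounded_range_perturb[OF bX YX] bounded_range_perturb[OF bX ZX] .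
  have bU: "bounded (range U)"
    using bounded_range_perturb[OF _ UAX] bounded_linear_image[OF bX A] by (simp add: image_image)
  obtain c where c0: "0 < c" "\<forall>\<^sub>F n in sequentially. c \<le> R n"
  proof -
    obtain c where c: "0 < ereal c" "ereal c < liminf (\<lambda>k. ereal (\<alpha>s k))"
      using ereal_dense2[OF \<alpha>s(2)] by blast
    have "\<forall>\<^sub>F k in sequentially. c < \<alpha>s k" using less_LiminfD[OF c(2)] by simp
    then have "\<forall>\<^sub>F n in sequentially. c < R n" unfolding R_def by (rule eventually_compose_filterlim[OF _ filterlim_Suc])
    then have "\<forall>\<^sub>F n in sequentially. c \<le> R n" by (rule eventually_mono) simp
    then show ?thesis using c(1) that[of c] by simp
  qed
  have cluster: "p \<in> \<Omega>" if r: "strict_mono r" and p: "weakly_convergent_to (X \<circ> r) p" for r p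
  proof -
    note sub = LIMSEQ_subseq_LIMSEQ[OF _ r, unfolded o_def]
    have X': "weakly_convergent_to (\<lambda>n. X (r n)) p" using p by (simp add: o_def)
    have Y': "weakly_convergent_to (\<lambda>n. Y (r n)) p" and Z': "weakly_convergent_to (\<lambda>n. Z (r n)) p"
      using weakly_convergent_to_perturb[OF X' sub[OF YX]] weakly_convergent_to_perturb[OF X' sub[OF ZX]] .
    have U': "weakly_convergent_to (\<lambda>n. U (r n)) (A p)"
      by (rule weakly_convergent_to_perturb[OF weakly_convergent_to_image[OF X' A] sub[OF UAX]])
    have bsub: "bounded (range (\<lambda>n. W (r n)))" if "bounded (range W)" for W :: "nat \<Rightarrow> 'c::real_normed_vector"
      using that by (rule bounded_subset) auto
    have "p \<in> Sol C f"
      by (rule weak_limit_of_prox_steps_in_Sol[OF C(2,3) f XC X' Y' bsub[OF bY] sub[OF XY] a L(1) Yn])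
    moreover have "p \<in> Fix C S"
      by (rule demiclosedness[OF C(2,3) S ZC Z' bsub[OF bZ] sub[OF ZS]])
    moreover have "A p \<in> Sol Q g"
      by (rule weak_limit_of_resolvents_in_Sol[OF Q(2,3) g Un U' bsub[OF bU] sub[OF UA] c0(1)])
        (rule eventually_subseq[OF r c0(2)])
    moreover have "A p \<in> Fix Q T"
      by (rule demiclosedness[OF Q(2,3) T UQ U' bsub[OF bU] sub[OF UT]])
    ultimately show ?thesis by (simp add: \<Omega>)
  qed
  obtain p where p: "p \<in> \<Omega>" "weakly_convergent_to X p"
    using fejer_weak_convergence[OF ne bX fejer cluster] .
  have "weakly_convergent_to x p" using p(2) weakly_convergent_to_Suc[of x p] by (simp add: X_def[abs_def])
  moreover have "weakly_convergent_to z p"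
    using weakly_convergent_to_perturb[OF p(2) ZX] weakly_convergent_to_Suc[of z p] by (simp add: Z_def[abs_def])
  moreover have "weakly_convergent_to u (A p)"
    using weakly_convergent_to_perturb[OF weakly_convergent_to_image[OF p(2) A] UAX]
      weakly_convergent_to_Suc[of u "A p"] by (simp add: U_def[abs_def])
  ultimately show ?thesis using p(1) by (auto simp: \<Omega>)
qed

end
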